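(* Let $(I,f)$, $f=f_{\mu,\pi}$, be a minimal $d$-IET that has a continuous embedding by $h$ into a $d$-PWI $(X,T)$, where $T(z)=T_j(z)=e^{i\theta_j}z+\lambda_j$ for $z\in X_j$, $j=1,\dots,d$. If the directed graph $\mathcal{G}_\pi$ is connected, then the parameters $\lambda_j,\theta_j$, $j=1,\dots,d$, satisfy the parametric connecting equation $$\sum_{j=1}^{d}\lambda_j\, r_j(\theta_1,\dots,\theta_d)=0$$ for each starting index $p_0\in\{0,\dots,d\}$, where $r_j(\theta_1,\dots,\theta_d)$ denotes the coefficient of $\lambda_j$ in $F_{p_0}(0)$ and $F_{p_0}$ is the connecting map for $p_0$.
   Context: IETs. Let $d\ge 2$, let $\pi$ be an irreducible permutation of $\{1,\dots,d\}$ (i.e. $\pi(\{1,\dots,k\})\ne\{1,\dots,k\}$ for $1\le k<d$), and let $\mu=(\mu_1,\dots,\mu_d)$ have positive real entries. Put $x_0=0$, $x_j=\sum_{k=1}^j\mu_k$, $I=[x_0,x_d)$, $I_j=[x_{j-1},x_j)$, and $\tau_j=\sum_{\pi(k)<\pi(j)}\mu_k-\sum_{k<j}\mu_k$. The $d$-interval exchange transformation ($d$-IET) $(I,f)$, $f=f_{\mu,\pi}:I\to I$, is the bijection $f(x)=x+\tau_j$ for $x\in I_j$. It is minimal if every orbit of $f$ is dense in $I$. PWIs. A $d$-PWI (orientation preserving planar piecewise isometry) $(X,T)$ consists of a set $X\subset\mathbb{C}$, a partition of $X$ into pairwise disjoint convex sets (atoms) $X_1,\dots,X_d$, and a map $T:X\to\mathbb{C}$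 with $T(z)=T_j(z)$ for $z\in X_j$, where $T_j:\mathbb{C}\to\mathbb{C}$, $T_j(z)=e^{i\theta_j}z+\lambda_j$, $\theta_j\in[0,2\pi)$, $\lambda_j\in\mathbb{C}$. (Points of $X$ may leave $X$ under $T$.) Embeddings. An injective map $h:I\to X$ is a piecewise continuous embedding of $(I,f)$ into $(X,T)$ if $h(I)$ is an invariant set for $(X,T)$, $h|_{I_j}$ is a homeomorphism onto its image and $h(I_j)\subset X_j$ for each $j$, and $h\circ f(x)=T\circ h(x)$ for all $x\in I$. It is a continuous embedding if moreover $h$ is continuous on $I$. The graph $\mathcal{G}_\pi$. For $j\in\mathbb{Z}$ write $[j]=j \bmod (d+1)\in\{0,\dots,d\}$; extend $\pi$ by $\pi(0)=0$. $\mathcal{G}_\pi$ is the directed graph with vertices $v_0,\dots,v_d$ in which, for $i,j\in\{0,\dots,d\}$, there is an edge $v_{\pi^{-1}([i-1])}\to v_{\pi^{-1}([j-1])}$ if and only if $\pi^{-1}([j-1])=[\pi^{-1}(i)-1]$. Each vertex has exactly one outgoing edge, and $\mathcal{G}_\pi$ is a disjoint union of directed cycles. Connecting map. Let $T_0$ be the identity map of $\mathbb{C}$. For $p_0\in\{0,\dots,d\}$ the connecting sequence $(p_k)_{k\ge0}$ is defined by $v_{p_{k-1}}\to v_{p_k}$ for $k\ge1$; it is periodic with minimal period $s=s(p_0)\le d+1$. The connecting map is $$F_{p_0}=T_{p_0}^{-1}\circ T_{\pi^{-1}([\pi(p_0)+1])}\circ\cdots\circ T_{p_{s-1}}^{-1}\circ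 T_{\pi^{-1}([\pi(p_{s-1})+1])}:\mathbb{C}\to\mathbb{C}.$$ Then $F_{p_0}(0)$ is a linear expression $\sum_{j=1}^d\lambda_j r_j(\theta_1,\dots,\theta_d)$ with coefficients $r_j$ depending only on $\theta_1,\dots,\theta_d$; the parametric connecting equation for $p_0$ is $\sum_{j=1}^d\lambda_j r_j(\theta_1,\dots,\theta_d)=0$. *)

theory Defs
  imports "HOL-Analysis.Analysis" "HOL-Combinatorics.Permutations" "Graph_Theory.Digraph_Component"
begin

section \<open>Interval exchange transformations\<close>

text \<open>Since \<open>\<pi> permutes {1..d}\<close> forces \<open>\<pi> 0 = 0\<close>, the extension of the permutation
  to \<open>{0..d}\<close> is built in, and \<open>inv \<pi>\<close> is the inverse permutation of \<open>{0..d}\<close>.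
  The real number is written \<open>pi\<close>; \<open>\<pi>\<close> is always a permutation.\<close>

definition irreducible_perm :: "nat \<Rightarrow> (nat \<Rightarrow> nat) \<Rightarrow> bool" where
  "irreducible_perm d \<pi> \<longleftrightarrow>
     \<pi> permutes {1..d} \<and> (\<forall>k. 1 \<le> k \<and> k < d \<longrightarrow> \<pi> ` {1..k} \<noteq> {1..k})"

definition iet_data :: "nat \<Rightarrow> (nat \<Rightarrow> nat) \<Rightarrow> (nat \<Rightarrow> real) \<Rightarrow> bool" where
  "iet_data d \<pi> \<mu> \<longleftrightarrow> 2 \<le> d \<and> irreducible_perm d \<pi> \<and> (\<forall>j\<in>{1..d}. 0 < \<mu> j)"

definition iet_pt :: "(nat \<Rightarrow> real) \<Rightarrow> nat \<Rightarrow> real" where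
  "iet_pt \<mu> j = (\<Sum>k=1..j. \<mu> k)"

definition iet_dom :: "nat \<Rightarrow> (nat \<Rightarrow> real) \<Rightarrow> real set" where
  "iet_dom d \<mu> = {iet_pt \<mu> 0..<iet_pt \<mu> d}"

definition iet_int :: "(nat \<Rightarrow> real) \<Rightarrow> nat \<Rightarrow> real set" where
  "iet_int \<mu> j = {iet_pt \<mu> (j - 1)..<iet_pt \<mu> j}"

definition iet_trans :: "nat \<Rightarrow> (nat \<Rightarrow> nat) \<Rightarrow> (nat \<Rightarrow> real) \<Rightarrow> nat \<Rightarrow> real" where
  "iet_trans d \<pi> \<mu> j =
     (\<Sum>k | k \<in> {1..d} \<and> \<pi> k < \<pi> j. \<mu> k) - (\<Sum>k\<in>{1..<j}. \<mu> k)"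

text \<open>The exchange as a total function; its values outside \<open>iet_dom d \<mu>\<close> are irrelevant.\<close>

definition iet :: "nat \<Rightarrow> (nat \<Rightarrow> nat) \<Rightarrow> (nat \<Rightarrow> real) \<Rightarrow> real \<Rightarrow> real" where
  "iet d \<pi> \<mu> x = x + iet_trans d \<pi> \<mu> (THE j. j \<in> {1..d} \<and> x \<in> iet_int \<mu> j)"

lemma iet_pt_mono:
  assumes "iet_data d \<pi> \<mu>" "i \<le> j" "j \<le> d"
  shows "iet_pt \<mu> i \<le> iet_pt \<mu> j"
  unfolding iet_pt_def
  by (rule sum_mono2) (use assms in \<open>auto simp: iet_data_def intro: less_imp_le\<close>)

lemma iet_eq:
  assumes "iet_data d \<pi> \<mu>" "j \<in> {1..d}" "x \<in> iet_int \<mu> j"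
  shows "iet d \<pi> \<mu> x = x + iet_trans d \<pi> \<mu> j"
proof -
  have "k = j" if k: "k \<in> {1..d}" "x \<in> iet_int \<mu> k" for k
  proof (rule ccontr)
    assume "k \<noteq> j"
    then consider "k \<le> j - 1" | "j \<le> k - 1" by linarith
    then show False
    proof cases
      case 1
      then have "iet_pt \<mu> k \<le> iet_pt \<mu> (j - 1)"
        using assms by (intro iet_pt_mono[OF assms(1)]) auto
      then show False using k assms(3) by (simp add: iet_int_def)
    next
      case 2
      then have "iet_pt \<mu> j \<le> iet_pt \<mu> (k - 1)"
        using k by (intro iet_pt_mono[OF assms(1)]) auto
      then show False using k assms(3) by (simp add: iet_int_def)
    qed
  qed
  then have "(THE k. k \<in> {1..d} \<and> x \<in> iet_int \<mu> k) = j" using assms by blast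
  then show ?thesis by (simp add: iet_def)
qed

text \<open>The (two-sided) orbit of a point under a bijection of \<open>I\<close>.\<close>

definition orbit_in :: "'a set \<Rightarrow> ('a \<Rightarrow> 'a) \<Rightarrow> 'a \<Rightarrow> 'a set" where
  "orbit_in I f x = {y \<in> I. \<exists>n. (f ^^ n) x = y \<or> (f ^^ n) y = x}"

definition iet_minimal :: "nat \<Rightarrow> (nat \<Rightarrow> nat) \<Rightarrow> (nat \<Rightarrow> real) \<Rightarrow> bool" where
  "iet_minimal d \<pi> \<mu> \<longleftrightarrow>
     (\<forall>x\<in>iet_dom d \<mu>. iet_dom d \<mu> \<subseteq> closure (orbit_in (iet_dom d \<mu>) (iet d \<pi> \<mu>) x))"

section \<open>Piecewise isometries and embeddings\<close>

text \<open>The case \<open>j = 0\<close> is the convention that \<open>T\<^sub>0\<close> is the identity map.\<close>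

definition pwi_map :: "(nat \<Rightarrow> real) \<Rightarrow> (nat \<Rightarrow> complex) \<Rightarrow> nat \<Rightarrow> complex \<Rightarrow> complex" where
  "pwi_map \<theta> lam j z = (if j = 0 then z else exp (\<i> * of_real (\<theta> j)) * z + lam j)"

definition is_pwi ::
  "nat \<Rightarrow> complex set \<Rightarrow> (nat \<Rightarrow> complex set) \<Rightarrow> (complex \<Rightarrow> complex) \<Rightarrow>
   (nat \<Rightarrow> real) \<Rightarrow> (nat \<Rightarrow> complex) \<Rightarrow> bool" where
  "is_pwi d X A T \<theta> lam \<longleftrightarrow>
     X = (\<Union>j\<in>{1..d}. A j) \<and> disjoint_family_on A {1..d} \<and>
     (\<forall>j\<in>{1..d}. A j \<noteq> {} \<and> convex (A j) \<and> \<theta> j \<in> {0..<2 * pi} \<and>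
        (\<forall>z\<in>A j. T z = pwi_map \<theta> lam j z))"

definition pw_continuous_embedding ::
  "nat \<Rightarrow> (nat \<Rightarrow> nat) \<Rightarrow> (nat \<Rightarrow> real) \<Rightarrow> complex set \<Rightarrow> (nat \<Rightarrow> complex set) \<Rightarrow>
   (complex \<Rightarrow> complex) \<Rightarrow> (real \<Rightarrow> complex) \<Rightarrow> bool" where
  "pw_continuous_embedding d \<pi> \<mu> X A T h \<longleftrightarrow>
     inj_on h (iet_dom d \<mu>) \<and> h ` iet_dom d \<mu> \<subseteq> X \<and>
     T ` (h ` iet_dom d \<mu>) \<subseteq> h ` iet_dom d \<mu> \<and>
     (\<forall>j\<in>{1..d}. (\<exists>g. homeomorphism (iet_int \<mu> j) (h ` iet_int \<mu> j) h g) \<and>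
        h ` iet_int \<mu> j \<subseteq> A j) \<and>
     (\<forall>x\<in>iet_dom d \<mu>. h (iet d \<pi> \<mu> x) = T (h x))"

definition continuous_embedding ::
  "nat \<Rightarrow> (nat \<Rightarrow> nat) \<Rightarrow> (nat \<Rightarrow> real) \<Rightarrow> complex set \<Rightarrow> (nat \<Rightarrow> complex set) \<Rightarrow>
   (complex \<Rightarrow> complex) \<Rightarrow> (real \<Rightarrow> complex) \<Rightarrow> bool" where
  "continuous_embedding d \<pi> \<mu> X A T h \<longleftrightarrow>
     pw_continuous_embedding d \<pi> \<mu> X A T h \<and> continuous_on (iet_dom d \<mu>) h"

section \<open>The graph and the connecting map\<close>

text \<open>\<open>idx d j\<close> is \<open>[j] = j mod (d + 1)\<close>; integer arguments make \<open>[-1] = d\<close>.\<close>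

definition idx :: "nat \<Rightarrow> int \<Rightarrow> nat" where
  "idx d j = nat (j mod (int d + 1))"

definition conn_graph :: "nat \<Rightarrow> (nat \<Rightarrow> nat) \<Rightarrow> nat pair_pre_digraph" where
  "conn_graph d \<pi> = \<lparr> pverts = {0..d},
     parcs = {(inv \<pi> (idx d (int i - 1)), inv \<pi> (idx d (int j - 1))) | i j.
       i \<in> {0..d} \<and> j \<in> {0..d} \<and>
       inv \<pi> (idx d (int j - 1)) = idx d (int (inv \<pi> i) - 1)} \<rparr>"

primrec conn_seq :: "nat \<Rightarrow> (nat \<Rightarrow> nat) \<Rightarrow> nat \<Rightarrow> nat \<Rightarrow> nat" where
  "conn_seq d \<pi> p 0 = p"
| "conn_seq d \<pi> p (Suc k) = (THE q. (conn_seq d \<pi> p k, q) \<in> parcs (conn_graph d \<pi>))"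

definition conn_period :: "nat \<Rightarrow> (nat \<Rightarrow> nat) \<Rightarrow> nat \<Rightarrow> nat" where
  "conn_period d \<pi> p =
     (LEAST s. 0 < s \<and> (\<forall>k. conn_seq d \<pi> p (k + s) = conn_seq d \<pi> p k))"

definition conn_map ::
  "nat \<Rightarrow> (nat \<Rightarrow> nat) \<Rightarrow> (nat \<Rightarrow> real) \<Rightarrow> (nat \<Rightarrow> complex) \<Rightarrow> nat \<Rightarrow> complex \<Rightarrow> complex" where
  "conn_map d \<pi> \<theta> lam p =
     foldr (\<circ>)
       (map (\<lambda>k. inv (pwi_map \<theta> lam (conn_seq d \<pi> p k)) \<circ>
                 pwi_map \<theta> lam (inv \<pi> (idx d (int (\<pi> (conn_seq d \<pi> p k)) + 1))))
         [0..<conn_period d \<pi> p])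
       id"

text \<open>The coefficients \<open>r\<^sub>j\<close> of the linear expression \<open>F(0)\<close> in the \<open>lam j\<close>, for fixed \<open>\<theta>\<close>;
  the support condition only normalises the function off the index set.
  See \<open>conn_coeff_unique\<close> and \<open>conn_map_zero_eq\<close> below.\<close>

definition conn_coeff ::
  "nat \<Rightarrow> (nat \<Rightarrow> nat) \<Rightarrow> nat \<Rightarrow> (nat \<Rightarrow> real) \<Rightarrow> nat \<Rightarrow> complex" where
  "conn_coeff d \<pi> p \<theta> =
     (THE r. (\<forall>j. j \<notin> {1..d} \<longrightarrow> r j = 0) \<and>
        (\<forall>lam. conn_map d \<pi> \<theta> lam p 0 = (\<Sum>j=1..d. lam j * r j)))"

lemma idx_le: "idx d j \<le> d"
proof -
  have "j mod (int d + 1) < int d + 1" by (rule pos_mod_bound) simp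
  then show ?thesis unfolding idx_def by linarith
qed

lemma idx_of_nat: "i \<le> d \<Longrightarrow> idx d (int i) = i"
  by (simp add: idx_def)

lemma idx_idx_pred: "idx d (int (idx d (int i + 1)) - 1) = idx d (int i)"
  by (simp add: idx_def mod_diff_left_eq)

lemma idx_idx_succ: "idx d (int (idx d (int i - 1)) + 1) = idx d (int i)"
  by (simp add: idx_def mod_add_left_eq)

lemma perm_le:
  assumes "\<pi> permutes {1..d}" "i \<le> d" shows "\<pi> i \<le> d"
  using assms permutes_in_image[OF assms(1), of i] permutes_not_in[OF assms(1), of i]
  by (cases "i \<in> {1..d}") auto

lemma conn_graph_arc_iff:
  assumes p: "\<pi> permutes {1..d}" and a: "a \<le> d"
  shows "(a, b) \<in> parcs (conn_graph d \<pi>) \<longleftrightarrow>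
    b = idx d (int (inv \<pi> (idx d (int (\<pi> a) + 1))) - 1)"
proof
  assume "(a, b) \<in> parcs (conn_graph d \<pi>)"
  then obtain i j where "i \<in> {0..d}" "a = inv \<pi> (idx d (int i - 1))"
    "b = inv \<pi> (idx d (int j - 1))"
    "inv \<pi> (idx d (int j - 1)) = idx d (int (inv \<pi> i) - 1)"
    unfolding conn_graph_def by auto
  then have ij: "i \<le> d" "a = inv \<pi> (idx d (int i - 1))" "b = idx d (int (inv \<pi> i) - 1)"
    by simp_all
  have "\<pi> a = idx d (int i - 1)" using ij p by (simp add: permutes_inverses)
  then have "idx d (int (\<pi> a) + 1) = i" using ij idx_idx_succ idx_of_nat by metis
  then show "b = idx d (int (inv \<pi> (idx d (int (\<pi> a) + 1))) - 1)" using ij by simp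
next
  assume b: "b = idx d (int (inv \<pi> (idx d (int (\<pi> a) + 1))) - 1)"
  define i where "i = idx d (int (\<pi> a) + 1)"
  define j where "j = idx d (int (\<pi> b) + 1)"
  have b': "b \<le> d" unfolding b by (rule idx_le)
  have ab: "inv \<pi> (idx d (int i - 1)) = a" "inv \<pi> (idx d (int j - 1)) = b"
    using p a b' by (auto simp: i_def j_def idx_idx_pred idx_of_nat perm_le permutes_inverses)
  have "i \<le> d" "j \<le> d" by (auto simp: i_def j_def idx_le)
  moreover have "inv \<pi> (idx d (int j - 1)) = idx d (int (inv \<pi> i) - 1)"
    unfolding ab(2) i_def by (rule b)
  ultimately have "\<exists>i j. (a, b) = (inv \<pi> (idx d (int i - 1)), inv \<pi> (idx d (int j - 1))) \<and>
      i \<in> {0..d} \<and> j \<in> {0..d} \<and>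
      inv \<pi> (idx d (int j - 1)) = idx d (int (inv \<pi> i) - 1)"
    using ab by (intro exI[of _ i] exI[of _ j]) (metis atLeastAtMost_iff le0)
  then show "(a, b) \<in> parcs (conn_graph d \<pi>)"
    unfolding conn_graph_def by simp
qed

lemma conn_seq_Suc:
  assumes "\<pi> permutes {1..d}" "conn_seq d \<pi> p k \<le> d"
  shows "conn_seq d \<pi> p (Suc k) =
    idx d (int (inv \<pi> (idx d (int (\<pi> (conn_seq d \<pi> p k)) + 1))) - 1)"
  by (simp add: conn_graph_arc_iff[OF assms])

lemma conn_seq_le:
  assumes "\<pi> permutes {1..d}" "p \<le> d"
  shows "conn_seq d \<pi> p k \<le> d"
  by (induction k) (use assms in \<open>auto simp: conn_graph_arc_iff idx_le\<close>)

lemma inv_pwi_map: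
  "inv (pwi_map \<theta> lam j) z =
     (if j = 0 then z else exp (- (\<i> * of_real (\<theta> j))) * (z - lam j))"
proof -
  have "inj (pwi_map \<theta> lam j)"
    by (auto simp: inj_on_def pwi_map_def)
  moreover have "pwi_map \<theta> lam j
      (if j = 0 then z else exp (- (\<i> * of_real (\<theta> j))) * (z - lam j)) = z"
    by (simp add: pwi_map_def exp_minus field_simps)
  ultimately show ?thesis by (rule inv_f_eq)
qed

definition lam_affine :: "nat \<Rightarrow> ((nat \<Rightarrow> complex) \<Rightarrow> complex \<Rightarrow> complex) \<Rightarrow> bool" where
  "lam_affine d G \<longleftrightarrow> (\<exists>a r. \<forall>lam z. G lam z = a * z + (\<Sum>j=1..d. lam j * r j))"

lemma lam_affineI:
  assumes "\<And>lam z. G lam z = a * z + (\<Sum>j=1..d. lam j * r j)"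
  shows "lam_affine d G"
  unfolding lam_affine_def using assms by meson

lemma lam_affine_comp:
  assumes "lam_affine d G" "lam_affine d H"
  shows "lam_affine d (\<lambda>lam. G lam \<circ> H lam)"
proof -
  obtain a r where 1: "\<And>lam z. G lam z = a * z + (\<Sum>j=1..d. lam j * r j)"
    using assms(1) unfolding lam_affine_def by blast
  obtain b s where 2: "\<And>lam z. H lam z = b * z + (\<Sum>j=1..d. lam j * s j)"
    using assms(2) unfolding lam_affine_def by blast
  have "(G lam \<circ> H lam) z = (a * b) * z + (\<Sum>j=1..d. lam j * (a * s j + r j))" for lam z
    by (simp add: 1 2 algebra_simps sum.distrib sum_distrib_left)
  then show ?thesis by (rule lam_affineI)
qed

lemma lam_affine_pwi_map:
  assumes "j \<le> d" shows "lam_affine d (\<lambda>lam. pwi_map \<theta> lam j)"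
proof -
  let ?r = "\<lambda>i. if i = j then 1 else (0::complex)"
  have "pwi_map \<theta> lam j z =
      (if j = 0 then 1 else exp (\<i> * of_real (\<theta> j))) * z + (\<Sum>i=1..d. lam i * ?r i)" for lam z
    using assms by (auto simp: pwi_map_def if_distrib[where f="\<lambda>x. _ * x"] cong: if_cong)
  then show ?thesis by (rule lam_affineI)
qed

lemma lam_affine_inv_pwi_map:
  assumes "j \<le> d" shows "lam_affine d (\<lambda>lam. inv (pwi_map \<theta> lam j))"
proof -
  let ?e = "exp (- (\<i> * of_real (\<theta> j)))"
  let ?r = "\<lambda>i. if i = j then - ?e else (0::complex)"
  have "inv (pwi_map \<theta> lam j) z =
      (if j = 0 then 1 else ?e) * z + (\<Sum>i=1..d. lam i * ?r i)" for lam z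
    using assms
    by (auto simp: inv_pwi_map algebra_simps if_distrib[where f="\<lambda>x. _ * x"] cong: if_cong)
  then show ?thesis by (rule lam_affineI)
qed

lemma lam_affine_conn_map:
  assumes "\<pi> permutes {1..d}" "p \<le> d"
  shows "lam_affine d (\<lambda>lam. conn_map d \<pi> \<theta> lam p)"
proof -
  define G where "G = (\<lambda>k lam. inv (pwi_map \<theta> lam (conn_seq d \<pi> p k)) \<circ>
    pwi_map \<theta> lam (inv \<pi> (idx d (int (\<pi> (conn_seq d \<pi> p k)) + 1))))"
  have G: "lam_affine d (G k)" for k
    unfolding G_def
  proof (rule lam_affine_comp)
    show "lam_affine d (\<lambda>lam. inv (pwi_map \<theta> lam (conn_seq d \<pi> p k)))"
      by (rule lam_affine_inv_pwi_map[OF conn_seq_le[OF assms]])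
    show "lam_affine d (\<lambda>lam. pwi_map \<theta> lam (inv \<pi> (idx d (int (\<pi> (conn_seq d \<pi> p k)) + 1))))"
      by (rule lam_affine_pwi_map[OF perm_le[OF permutes_inv[OF assms(1)] idx_le]])
  qed
  have "lam_affine d (\<lambda>lam. foldr (\<circ>) (map (\<lambda>k. G k lam) ks) id)" for ks
  proof (induction ks)
    case Nil
    have "id z = 1 * z + (\<Sum>j=1..d. lam j * 0)" for lam :: "nat \<Rightarrow> complex" and z :: complex
      by simp
    then have "lam_affine d (\<lambda>_. id)" by (rule lam_affineI)
    then show ?case by (simp add: id_def)
  next
    case (Cons k ks)
    from lam_affine_comp[OF G Cons.IH] show ?case by (simp add: comp_def)
  qed
  then show ?thesis by (simp add: conn_map_def G_def)
qed

lemma conn_coeff_unique: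
  assumes "\<pi> permutes {1..d}" "p \<le> d"
  shows "\<exists>!r. (\<forall>j. j \<notin> {1..d} \<longrightarrow> r j = 0) \<and>
    (\<forall>lam. conn_map d \<pi> \<theta> lam p 0 = (\<Sum>j=1..d. lam j * r j))"
proof -
  obtain a r where r: "\<And>lam z. conn_map d \<pi> \<theta> lam p z = a * z + (\<Sum>j=1..d. lam j * r j)"
    using lam_affine_conn_map[OF assms] unfolding lam_affine_def by blast
  show ?thesis
  proof (rule ex1I[of _ "\<lambda>j. if j \<in> {1..d} then r j else 0"])
    show "(\<forall>j. j \<notin> {1..d} \<longrightarrow> (if j \<in> {1..d} then r j else 0) = 0) \<and>
      (\<forall>lam. conn_map d \<pi> \<theta> lam p 0 = (\<Sum>j=1..d. lam j * (if j \<in> {1..d} then r j else 0)))"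
      by (simp add: r)
  next
    fix s
    assume s: "(\<forall>j. j \<notin> {1..d} \<longrightarrow> s j = 0) \<and>
      (\<forall>lam. conn_map d \<pi> \<theta> lam p 0 = (\<Sum>j=1..d. lam j * s j))"
    have "s i = r i" if "i \<in> {1..d}" for i
    proof -
      have sel: "(\<Sum>j=1..d. (if j = i then 1 else 0) * t j) = t i" for t :: "nat \<Rightarrow> complex"
        using that by (simp add: if_distrib[where f="\<lambda>x. x * _"] cong: if_cong)
      show ?thesis using s r[of "\<lambda>j. if j = i then 1 else 0" 0] sel[of s] sel[of r] by simp
    qed
    with s show "s = (\<lambda>j. if j \<in> {1..d} then r j else 0)" by auto
  qed
qed

lemma conn_map_zero_eq:
  assumes "\<pi> permutes {1..d}" "p \<le> d"
  shows "conn_map d \<pi> \<theta> lam p 0 = (\<Sum>j=1..d. lam j * conn_coeff d \<pi> p \<theta> j)"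
  using theI'[OF conn_coeff_unique[OF assms, of \<theta>]] unfolding conn_coeff_def by blast

end

theory Submission
  imports Defs
begin

text \<open>
  Write \<open>y\<^sub>m\<close> for the right end of the \<open>m\<close>-th interval after the
  exchange.  Irreducibility forces \<open>\<pi> d \<noteq> d\<close>, so \<open>f\<close> carries \<open>I\<^sub>d\<close> to an interval whose closure
  lies inside \<open>I\<close>; conjugating by \<open>T\<^sub>d\<close> shows that \<open>h\<close> has a limit at the right end of \<open>I\<close>.
  The extended curve \<open>H\<close> is continuous on the closed interval, and by continuity
  \<open>T\<^sub>j (H x) = H (x + \<tau>\<^sub>j)\<close> holds on the closure of each \<open>I\<^sub>j\<close>
  (\<open>embedding_extends_to_closure\<close>).  Read at both ends of the closed intervals, this says
  \<open>T\<^sub>j (H x\<^sub>j) = H y\<^bsub>\<pi> j\<^esub>\<close> and \<open>T\<^sub>j (H x\<^bsub>j-1\<^esub>) = H y\<^bsub>\<pi> j - 1\<^esub>\<close>.  If \<open>p \<rightarrow> q\<close> is an edge of the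
  graph, then \<open>x\<^sub>q\<close> is the left end of the interval which the exchange puts to the right of
  \<open>I\<^sub>p\<close>, so the two identities share the value \<open>H y\<^bsub>\<pi> p\<^esub>\<close>, and the factor of the connecting map
  that belongs to \<open>p\<close> sends \<open>H x\<^sub>q\<close> to \<open>H x\<^sub>p\<close> (\<open>embedding_vertex_points\<close>).  The convention
  \<open>T\<^sub>0 = id\<close> makes this correct at the two ends of \<open>I\<close> too.  Going once around the cycle, the
  connecting map fixes \<open>H x\<^bsub>p\<^sub>0\<^esub>\<close>.

  Connectedness enters through the linear part.  It means that the cycle of \<open>p\<^sub>0\<close> passes through
  every vertex exactly once (\<open>conn_seq_bij_betw\<close>), so each of the rotations \<open>e\<^bsup>i\<theta>\<^sub>j\<^esup>\<close> occurs in the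
  connecting map once directly and once inverted.  The connecting map is therefore a
  translation, and a translation with a fixed point is the identity; in particular it
  sends \<open>0\<close> to \<open>0\<close>.
\<close>

section \<open>Cycles of a permutation of a finite set\<close>

lemma funpow_cycle:
  fixes \<sigma> :: "'a \<Rightarrow> 'a"
  assumes "finite V" "bij_betw \<sigma> V V" "p \<in> V"
  defines "s \<equiv> LEAST s. 0 < s \<and> (\<forall>k. (\<sigma> ^^ (k + s)) p = (\<sigma> ^^ k) p)"
  shows "(\<sigma> ^^ s) p = p"
    and "bij_betw (\<lambda>k. (\<sigma> ^^ k) p) {0..<s} (range (\<lambda>k. (\<sigma> ^^ k) p))"
    and "a \<in> V \<Longrightarrow> \<sigma> a \<in> range (\<lambda>k. (\<sigma> ^^ k) p) \<longleftrightarrow> a \<in> range (\<lambda>k. (\<sigma> ^^ k) p)"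
proof -
  have bij: "bij_betw (\<sigma> ^^ n) V V" for n
    by (rule bij_betw_funpow[OF assms(2)])
  have mem: "(\<sigma> ^^ n) p \<in> V" for n
    using bij assms(3) by (meson bij_betwE)
  have return: "(\<sigma> ^^ (j - i)) p = p" if "i \<le> j" "(\<sigma> ^^ i) p = (\<sigma> ^^ j) p" for i j
  proof -
    have "(\<sigma> ^^ i) ((\<sigma> ^^ (j - i)) p) = (\<sigma> ^^ i) p"
      using that funpow_add[of i "j - i" \<sigma>] by simp
    then show ?thesis
      using bij_betw_imp_inj_on[OF bij[of i]] mem[of "j - i"] assms(3) by (meson inj_onD)
  qed
  have period: "(\<forall>k. (\<sigma> ^^ (k + t)) p = (\<sigma> ^^ k) p) \<longleftrightarrow> (\<sigma> ^^ t) p = p" for t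
    by (auto simp: funpow_add dest: spec[of _ 0])
  have s_eq: "s = (LEAST s. 0 < s \<and> (\<sigma> ^^ s) p = p)"
    unfolding s_def period ..
  have "\<not> inj (\<lambda>k. (\<sigma> ^^ k) p)"
    using inj_on_finite[of "\<lambda>k. (\<sigma> ^^ k) p" UNIV V] mem assms(1) by auto
  then obtain i j where ij: "i < j" "(\<sigma> ^^ i) p = (\<sigma> ^^ j) p"
    by (meson linorder_injI)
  have "0 < j - i \<and> (\<sigma> ^^ (j - i)) p = p"
    using return[OF less_imp_le[OF ij(1)] ij(2)] ij(1) by simp
  then have s: "0 < s" "(\<sigma> ^^ s) p = p"
    unfolding s_eq using LeastI[of "\<lambda>s. 0 < s \<and> (\<sigma> ^^ s) p = p" "j - i"] by blast+
  then show "(\<sigma> ^^ s) p = p" by blast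
  have least: "s \<le> t" if "0 < t" "(\<sigma> ^^ t) p = p" for t
    unfolding s_eq using that by (simp add: Least_le)
  have "inj_on (\<lambda>k. (\<sigma> ^^ k) p) {0..<s}"
  proof (rule linorder_inj_onI')
    fix i j assume "i \<in> {0..<s}" "j \<in> {0..<s}" "i < j"
    then show "(\<sigma> ^^ i) p \<noteq> (\<sigma> ^^ j) p"
      using return[of i j] least[of "j - i"] by auto
  qed
  moreover have "(\<lambda>k. (\<sigma> ^^ k) p) ` {0..<s} = range (\<lambda>k. (\<sigma> ^^ k) p)"
  proof -
    have "(\<sigma> ^^ k) p = (\<sigma> ^^ (k mod s)) p" for k
      using funpow_mod_eq[where f = \<sigma> and x = p and n = s and m = k, OF s(2)] by simp
    then show ?thesis
      using s(1) by (force intro: image_eqI[where x = "_ mod s"])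
  qed
  ultimately show "bij_betw (\<lambda>k. (\<sigma> ^^ k) p) {0..<s} (range (\<lambda>k. (\<sigma> ^^ k) p))"
    by (simp add: bij_betw_def)
  show "\<sigma> a \<in> range (\<lambda>k. (\<sigma> ^^ k) p) \<longleftrightarrow> a \<in> range (\<lambda>k. (\<sigma> ^^ k) p)" if a: "a \<in> V"
  proof
    assume "a \<in> range (\<lambda>k. (\<sigma> ^^ k) p)"
    then obtain k where "a = (\<sigma> ^^ k) p" by blast
    then have "\<sigma> a = (\<sigma> ^^ Suc k) p" by simp
    then show "\<sigma> a \<in> range (\<lambda>k. (\<sigma> ^^ k) p)" by blast
  next
    assume "\<sigma> a \<in> range (\<lambda>k. (\<sigma> ^^ k) p)"
    then obtain k where k: "\<sigma> a = (\<sigma> ^^ k) p" by blast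
    \<comment> \<open>Moving the exponent up by a full period makes it positive, so that one \<open>\<sigma>\<close> can be cancelled.\<close>
    have "\<sigma> a = (\<sigma> ^^ (k + s)) p" using k s(2) by (simp add: funpow_add)
    also have "\<dots> = \<sigma> ((\<sigma> ^^ (k + s - 1)) p)"
      using s(1) by (cases "k + s") simp_all
    finally have "a = (\<sigma> ^^ (k + s - 1)) p"
      using bij_betw_imp_inj_on[OF assms(2)] mem a by (meson inj_onD)
    then show "a \<in> range (\<lambda>k. (\<sigma> ^^ k) p)" by blast
  qed
qed

lemma connected_closed_set:
  assumes "Digraph_Component.connected G" "u \<in> S" "u \<in> verts G"
    and closed: "\<And>e. e \<in> arcs G \<Longrightarrow> tail G e \<in> S \<longleftrightarrow> head G e \<in> S"
  shows "verts G \<subseteq> S"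
proof
  fix v assume "v \<in> verts G"
  then have "(u, v) \<in> rtrancl_on (verts G) (parcs (mk_symmetric G))"
    using assms(1,3)
    by (simp add: Digraph_Component.connected_def strongly_connected_def reachable_def)
  then show "v \<in> S"
  proof (induction rule: rtrancl_on_induct)
    case base
    show ?case by (rule assms(2))
  next
    case (step x y)
    then show ?case using closed by (auto simp: parcs_mk_symmetric)
  qed
qed

section \<open>The successor map of the connecting graph\<close>

text \<open>The label of the interval that the exchange places immediately to the right of \<open>I\<^sub>a\<close>,
  where the label \<open>0\<close> stands for the outside of \<open>I\<close> on either side.\<close>

definition right_neighbour :: "nat \<Rightarrow> (nat \<Rightarrow> nat) \<Rightarrow> nat \<Rightarrow> nat" where
  "right_neighbour d \<pi> a = inv \<pi> (idx d (int (\<pi> a) + 1))"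

definition conn_next :: "nat \<Rightarrow> (nat \<Rightarrow> nat) \<Rightarrow> nat \<Rightarrow> nat" where
  "conn_next d \<pi> a = idx d (int (right_neighbour d \<pi> a) - 1)"

lemma bij_betw_right_neighbour:
  assumes "\<pi> permutes {1..d}"
  shows "bij_betw (right_neighbour d \<pi>) {0..d} {0..d}"
proof (rule bij_betw_byWitness[where f' = "\<lambda>b. inv \<pi> (idx d (int (\<pi> b) - 1))"])
  note le = perm_le[OF assms] perm_le[OF permutes_inv[OF assms]]
  show "\<forall>a\<in>{0..d}. inv \<pi> (idx d (int (\<pi> (right_neighbour d \<pi> a)) - 1)) = a"
    by (simp add: right_neighbour_def permutes_inverses[OF assms] idx_idx_pred idx_of_nat le)
  show "\<forall>b\<in>{0..d}. right_neighbour d \<pi> (inv \<pi> (idx d (int (\<pi> b) - 1))) = b"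
    by (simp add: right_neighbour_def permutes_inverses[OF assms] idx_idx_succ idx_of_nat le)
  show "right_neighbour d \<pi> ` {0..d} \<subseteq> {0..d}"
    "(\<lambda>b. inv \<pi> (idx d (int (\<pi> b) - 1))) ` {0..d} \<subseteq> {0..d}"
    by (simp_all add: right_neighbour_def image_subset_iff le idx_le)
qed

lemma bij_betw_conn_next:
  assumes "\<pi> permutes {1..d}"
  shows "bij_betw (conn_next d \<pi>) {0..d} {0..d}"
proof -
  have "bij_betw (\<lambda>b. idx d (int b - 1)) {0..d} {0..d}"
    by (rule bij_betw_byWitness[where f' = "\<lambda>b. idx d (int b + 1)"])
      (auto simp: idx_idx_pred idx_idx_succ idx_of_nat idx_le)
  from bij_betw_trans[OF bij_betw_right_neighbour[OF assms] this]
  show ?thesis by (simp add: conn_next_def[abs_def] comp_def)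
qed

lemma conn_seq_eq_funpow:
  assumes "\<pi> permutes {1..d}" "p \<le> d"
  shows "conn_seq d \<pi> p k = (conn_next d \<pi> ^^ k) p"
proof (induction k)
  case (Suc k)
  then show ?case
    using conn_seq_Suc[OF assms(1) conn_seq_le[OF assms], of k]
    by (simp add: conn_next_def right_neighbour_def del: conn_seq.simps(2))
qed simp

lemma conn_seq_period:
  assumes "\<pi> permutes {1..d}" "p \<le> d"
  shows "conn_seq d \<pi> p (conn_period d \<pi> p) = p"
  using funpow_cycle(1)[OF _ bij_betw_conn_next[OF assms(1)], of p] assms(2)
  unfolding conn_period_def conn_seq_eq_funpow[OF assms] by simp

text \<open>The arcs of the graph are the pairs \<open>(a, conn_next a)\<close>, so the set of vertices visited by the
  connecting sequence is closed under arcs in both directions; in a connected graph it is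
  everything.\<close>

lemma conn_seq_bij_betw:
  assumes "\<pi> permutes {1..d}" "p \<le> d"
    and "Digraph_Component.connected (with_proj (conn_graph d \<pi>))"
  shows "bij_betw (conn_seq d \<pi> p) {0..<conn_period d \<pi> p} {0..d}"
proof -
  let ?O = "range (\<lambda>k. (conn_next d \<pi> ^^ k) p)"
  have p: "p \<in> {0..d}" using assms(2) by simp
  note cyc = funpow_cycle[OF finite_atLeastAtMost bij_betw_conn_next[OF assms(1)] p]
  have eq: "conn_seq d \<pi> p = (\<lambda>k. (conn_next d \<pi> ^^ k) p)"
    using conn_seq_eq_funpow[OF assms(1,2)] by blast
  have arc: "a \<in> {0..d} \<and> b = conn_next d \<pi> a" if "(a, b) \<in> parcs (conn_graph d \<pi>)" for a b
  proof -
    have "a \<le> d"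
      using that perm_le[OF permutes_inv[OF assms(1)] idx_le] by (auto simp: conn_graph_def)
    then show ?thesis
      using that conn_graph_arc_iff[OF assms(1)] by (simp add: conn_next_def right_neighbour_def)
  qed
  have "p \<in> ?O" by (rule range_eqI[of _ _ 0]) simp
  then have "verts (with_proj (conn_graph d \<pi>)) \<subseteq> ?O"
  proof (rule connected_closed_set[OF assms(3)])
    show "p \<in> verts (with_proj (conn_graph d \<pi>))" using p by (simp add: conn_graph_def)
  next
    fix e assume e: "e \<in> arcs (with_proj (conn_graph d \<pi>))"
    then show "tail (with_proj (conn_graph d \<pi>)) e \<in> ?O \<longleftrightarrow>
        head (with_proj (conn_graph d \<pi>)) e \<in> ?O"
      using arc[of "fst e" "snd e"] cyc(3)[of "fst e"] by simp
  qed
  then have "?O = {0..d}"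
    using conn_seq_le[OF assms(1,2)] by (auto simp: eq conn_graph_def)
  then show ?thesis
    using cyc(2) unfolding conn_period_def eq by simp
qed

section \<open>The linear part of the connecting map\<close>

definition pwi_rot :: "(nat \<Rightarrow> real) \<Rightarrow> nat \<Rightarrow> complex" where
  "pwi_rot \<theta> j = (if j = 0 then 1 else exp (\<i> * of_real (\<theta> j)))"

lemma pwi_rot_nonzero [simp]: "pwi_rot \<theta> j \<noteq> 0"
  by (simp add: pwi_rot_def)

lemma pwi_map_diff: "pwi_map \<theta> lam j z - pwi_map \<theta> lam j w = pwi_rot \<theta> j * (z - w)"
  by (simp add: pwi_map_def pwi_rot_def algebra_simps)

lemma inv_pwi_map_apply [simp]: "inv (pwi_map \<theta> lam j) (pwi_map \<theta> lam j z) = z"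
  by (simp add: inv_pwi_map pwi_map_def exp_minus field_simps)

lemma pwi_map_inv_apply [simp]: "pwi_map \<theta> lam j (inv (pwi_map \<theta> lam j) z) = z"
  by (simp add: inv_pwi_map pwi_map_def exp_minus field_simps)

lemma inv_pwi_map_diff:
  "inv (pwi_map \<theta> lam j) z - inv (pwi_map \<theta> lam j) w = (z - w) / pwi_rot \<theta> j"
  using pwi_map_diff[of \<theta> lam j "inv (pwi_map \<theta> lam j) z" "inv (pwi_map \<theta> lam j) w"]
  by (simp add: field_simps)

lemma foldr_comp_upt_Suc:
  "foldr (\<circ>) (map G [0..<Suc n]) id x = foldr (\<circ>) (map G [0..<n]) id (G n x)"
proof -
  have "foldr (\<circ>) gs g x = foldr (\<circ>) gs id (g x)" for gs and g :: "'a \<Rightarrow> 'a"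
    by (induction gs) simp_all
  from this[of "map G [0..<n]" "G n"] show ?thesis by simp
qed

lemma conn_map_diff:
  "conn_map d \<pi> \<theta> lam p z - conn_map d \<pi> \<theta> lam p w =
    (\<Prod>k\<in>{0..<conn_period d \<pi> p}. pwi_rot \<theta> (right_neighbour d \<pi> (conn_seq d \<pi> p k)) /
       pwi_rot \<theta> (conn_seq d \<pi> p k)) * (z - w)"
proof -
  define G where "G = (\<lambda>k. inv (pwi_map \<theta> lam (conn_seq d \<pi> p k)) \<circ>
    pwi_map \<theta> lam (right_neighbour d \<pi> (conn_seq d \<pi> p k)))"
  have "foldr (\<circ>) (map G [0..<n]) id z - foldr (\<circ>) (map G [0..<n]) id w =
    (\<Prod>k\<in>{0..<n}. pwi_rot \<theta> (right_neighbour d \<pi> (conn_seq d \<pi> p k)) /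
       pwi_rot \<theta> (conn_seq d \<pi> p k)) * (z - w)" for n
  proof (induction n arbitrary: z w)
    case (Suc n)
    have "G n z - G n w = pwi_rot \<theta> (right_neighbour d \<pi> (conn_seq d \<pi> p n)) /
       pwi_rot \<theta> (conn_seq d \<pi> p n) * (z - w)"
      by (simp add: G_def inv_pwi_map_diff pwi_map_diff)
    then show ?case
      unfolding foldr_comp_upt_Suc Suc.IH by simp
  qed simp
  then show ?thesis
    by (simp add: conn_map_def G_def right_neighbour_def)
qed

text \<open>In a connected graph numerators and denominators of the linear part run over the same full
  set of rotations, since \<open>right_neighbour\<close> is a bijection.\<close>

lemma conn_map_translation:
  assumes "\<pi> permutes {1..d}" "p \<le> d"
    and "Digraph_Component.connected (with_proj (conn_graph d \<pi>))"
  shows "conn_map d \<pi> \<theta> lam p z - conn_map d \<pi> \<theta> lam p w = z - w"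
proof -
  have "(\<Prod>k\<in>{0..<conn_period d \<pi> p}. pwi_rot \<theta> (right_neighbour d \<pi> (conn_seq d \<pi> p k)) /
       pwi_rot \<theta> (conn_seq d \<pi> p k)) =
    (\<Prod>a\<in>{0..d}. pwi_rot \<theta> (right_neighbour d \<pi> a) / pwi_rot \<theta> a)"
    by (rule prod.reindex_bij_betw[OF conn_seq_bij_betw[OF assms],
          where g = "\<lambda>a. pwi_rot \<theta> (right_neighbour d \<pi> a) / pwi_rot \<theta> a"])
  also have "\<dots> = (\<Prod>a\<in>{0..d}. pwi_rot \<theta> (right_neighbour d \<pi> a)) / (\<Prod>a\<in>{0..d}. pwi_rot \<theta> a)"
    by (rule prod_dividef)
  also have "(\<Prod>a\<in>{0..d}. pwi_rot \<theta> (right_neighbour d \<pi> a)) = (\<Prod>a\<in>{0..d}. pwi_rot \<theta> a)"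
    by (rule prod.reindex_bij_betw[OF bij_betw_right_neighbour[OF assms(1)]])
  finally have "(\<Prod>k\<in>{0..<conn_period d \<pi> p}. pwi_rot \<theta> (right_neighbour d \<pi> (conn_seq d \<pi> p k)) /
       pwi_rot \<theta> (conn_seq d \<pi> p k)) = 1"
    by simp
  then show ?thesis using conn_map_diff[of d \<pi> \<theta> lam p z w] by simp
qed

text \<open>A family of points that each factor of the connecting map carries one step backwards along the
  graph telescopes around the cycle.\<close>

lemma conn_map_fixed_point:
  assumes "\<pi> permutes {1..d}" "p \<le> d"
    and step: "\<And>a. a \<le> d \<Longrightarrow>
      pwi_map \<theta> lam (right_neighbour d \<pi> a) (V (conn_next d \<pi> a)) = pwi_map \<theta> lam a (V a)"
  shows "conn_map d \<pi> \<theta> lam p (V p) = V p"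
proof -
  define G where "G = (\<lambda>k. inv (pwi_map \<theta> lam (conn_seq d \<pi> p k)) \<circ>
    pwi_map \<theta> lam (right_neighbour d \<pi> (conn_seq d \<pi> p k)))"
  have G: "G k (V (conn_seq d \<pi> p (Suc k))) = V (conn_seq d \<pi> p k)" for k
    using step[OF conn_seq_le[OF assms(1,2)], of k]
    by (simp add: G_def conn_seq_eq_funpow[OF assms(1,2)] del: conn_seq.simps(2))
  have "foldr (\<circ>) (map G [0..<n]) id (V (conn_seq d \<pi> p n)) = V p" for n
  proof (induction n)
    case (Suc n)
    show ?case unfolding foldr_comp_upt_Suc G by (rule Suc.IH)
  qed simp
  from this[of "conn_period d \<pi> p"] show ?thesis
    by (simp add: conn_seq_period[OF assms(1,2)] conn_map_def G_def right_neighbour_def)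
qed

section \<open>Endpoints before and after the exchange\<close>

definition iet_image_pt :: "nat \<Rightarrow> (nat \<Rightarrow> nat) \<Rightarrow> (nat \<Rightarrow> real) \<Rightarrow> nat \<Rightarrow> real" where
  "iet_image_pt d \<pi> \<mu> m = (\<Sum>k | k \<in> {1..d} \<and> \<pi> k \<le> m. \<mu> k)"

lemma iet_dataD:
  assumes "iet_data d \<pi> \<mu>"
  shows "2 \<le> d" "\<pi> permutes {1..d}" "\<And>j. j \<in> {1..d} \<Longrightarrow> 0 < \<mu> j"
    and "\<And>j. j \<in> {1..d} \<Longrightarrow> \<pi> j \<in> {1..d}"
proof -
  show "2 \<le> d" "\<pi> permutes {1..d}" "\<And>j. j \<in> {1..d} \<Longrightarrow> 0 < \<mu> j"
    using assms by (auto simp: iet_data_def irreducible_perm_def)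
  then show "\<And>j. j \<in> {1..d} \<Longrightarrow> \<pi> j \<in> {1..d}" by (metis permutes_in_image)
qed

lemma irreducible_perm_last:
  assumes "iet_data d \<pi> \<mu>"
  shows "\<pi> d < d"
proof (rule ccontr)
  assume "\<not> \<pi> d < d"
  note d = iet_dataD[OF assms]
  have last: "\<pi> d = d" using \<open>\<not> \<pi> d < d\<close> d(4)[of d] d(1) by simp
  have "{1..d - 1} = {1..d} - {d}" using d(1) by auto
  then have "\<pi> ` {1..d - 1} = \<pi> ` {1..d} - \<pi> ` {d}"
    using permutes_inj[OF d(2)] by (simp add: image_set_diff)
  also have "\<dots> = {1..d - 1}"
    using last permutes_image[OF d(2)] \<open>{1..d - 1} = {1..d} - {d}\<close> by simp
  finally show False
    using assms d(1) by (auto simp: iet_data_def irreducible_perm_def dest!: spec[of _ "d - 1"])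
qed

lemma iet_pt_strict_mono:
  assumes "iet_data d \<pi> \<mu>" "i < j" "j \<le> d"
  shows "iet_pt \<mu> i < iet_pt \<mu> j"
  unfolding iet_pt_def
  by (rule sum_strict_mono2[where b = j]) (use assms iet_dataD(3)[OF assms(1)] in \<open>auto intro: less_imp_le\<close>)

lemma iet_pt_succ:
  assumes "j \<in> {1..d}"
  shows "iet_pt \<mu> j = iet_pt \<mu> (j - 1) + \<mu> j"
  using assms by (cases j) (auto simp: iet_pt_def)

lemma iet_image_pt_0:
  assumes "iet_data d \<pi> \<mu>"
  shows "iet_image_pt d \<pi> \<mu> 0 = iet_pt \<mu> 0"
proof -
  have "{k. k \<in> {1..d} \<and> \<pi> k \<le> 0} = {}" using iet_dataD(4)[OF assms] by fastforce
  then show ?thesis unfolding iet_image_pt_def by (simp only: iet_pt_def) simp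
qed

lemma iet_image_pt_d:
  assumes "iet_data d \<pi> \<mu>"
  shows "iet_image_pt d \<pi> \<mu> d = iet_pt \<mu> d"
proof -
  have "{k. k \<in> {1..d} \<and> \<pi> k \<le> d} = {1..d}" using iet_dataD(4)[OF assms] by fastforce
  then show ?thesis by (simp add: iet_image_pt_def iet_pt_def)
qed

lemma iet_image_pt_mono:
  assumes "iet_data d \<pi> \<mu>" "m \<le> n"
  shows "iet_image_pt d \<pi> \<mu> m \<le> iet_image_pt d \<pi> \<mu> n"
  unfolding iet_image_pt_def
  by (rule sum_mono2) (use assms iet_dataD(3)[OF assms(1)] in \<open>auto intro: less_imp_le\<close>)

lemma iet_image_pt_succ:
  assumes "iet_data d \<pi> \<mu>" "j \<in> {1..d}"
  shows "iet_image_pt d \<pi> \<mu> (\<pi> j) = iet_image_pt d \<pi> \<mu> (\<pi> j - 1) + \<mu> j"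
proof -
  have "{k. k \<in> {1..d} \<and> \<pi> k \<le> \<pi> j} = insert j {k. k \<in> {1..d} \<and> \<pi> k \<le> \<pi> j - 1}"
  proof -
    have "\<pi> k \<le> \<pi> j \<longleftrightarrow> k = j \<or> \<pi> k \<le> \<pi> j - 1" for k
    proof -
      have "\<pi> k \<noteq> \<pi> j" if "k \<noteq> j"
        using that permutes_inj[OF iet_dataD(2)[OF assms(1)]] by (simp add: inj_eq)
      then show ?thesis by (cases "k = j") auto
    qed
    then show ?thesis using assms(2) by auto
  qed
  moreover have "j \<notin> {k. k \<in> {1..d} \<and> \<pi> k \<le> \<pi> j - 1}"
    using iet_dataD(4)[OF assms] by auto
  ultimately show ?thesis by (simp add: iet_image_pt_def)
qed

lemma iet_trans_left:
  assumes "iet_data d \<pi> \<mu>" "j \<in> {1..d}"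
  shows "iet_pt \<mu> (j - 1) + iet_trans d \<pi> \<mu> j = iet_image_pt d \<pi> \<mu> (\<pi> j - 1)"
proof -
  have "{1..<j} = {1..j - 1}" using assms(2) by auto
  moreover have "{k. k \<in> {1..d} \<and> \<pi> k < \<pi> j} = {k. k \<in> {1..d} \<and> \<pi> k \<le> \<pi> j - 1}"
    using iet_dataD(4)[OF assms] by auto
  ultimately show ?thesis by (simp add: iet_pt_def iet_trans_def iet_image_pt_def)
qed

lemma iet_trans_right:
  assumes "iet_data d \<pi> \<mu>" "j \<in> {1..d}"
  shows "iet_pt \<mu> j + iet_trans d \<pi> \<mu> j = iet_image_pt d \<pi> \<mu> (\<pi> j)"
  using iet_trans_left[OF assms] iet_image_pt_succ[OF assms] iet_pt_succ[OF assms(2), of \<mu>]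
  by simp

lemma iet_trans_closed_interval:
  assumes "iet_data d \<pi> \<mu>" "j \<in> {1..d}" "x \<in> {iet_pt \<mu> (j - 1)..iet_pt \<mu> j}"
  shows "x + iet_trans d \<pi> \<mu> j \<in> {iet_pt \<mu> 0..iet_image_pt d \<pi> \<mu> (\<pi> j)}"
  using iet_trans_left[OF assms(1,2)] iet_trans_right[OF assms(1,2)] assms(3)
    iet_image_pt_mono[OF assms(1), of 0 "\<pi> j - 1"] iet_image_pt_0[OF assms(1)] by auto

section \<open>The embedded curve at the endpoints\<close>

lemma continuous_on_pwi_map: "continuous_on S (pwi_map \<theta> lam j)"
  unfolding pwi_map_def[abs_def] by (cases "j = 0") (auto intro!: continuous_intros)

lemma continuous_on_inv_pwi_map: "continuous_on S (inv (pwi_map \<theta> lam j))"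
  unfolding inv_pwi_map[abs_def] by (cases "j = 0") (auto intro!: continuous_intros)

text \<open>An embedding as a map of \<open>[x\<^sub>0, x\<^sub>d)\<close> does not obviously converge at \<open>x\<^sub>d\<close>.  It does because
  \<open>h = T\<^sub>d\<^sup>-\<^sup>1 \<circ> h \<circ> f\<close> on \<open>I\<^sub>d\<close>, where \<open>f\<close> moves \<open>I\<^sub>d\<close> away from the right end of \<open>I\<close>.\<close>

lemma embedding_extends_to_closure:
  assumes iet: "iet_data d \<pi> \<mu>" and pwi: "is_pwi d X A T \<theta> lam"
    and emb: "continuous_embedding d \<pi> \<mu> X A T h"
  obtains H where "continuous_on {iet_pt \<mu> 0..iet_pt \<mu> d} H"
    and "\<And>x. x \<in> iet_dom d \<mu> \<Longrightarrow> H x = h x"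
    and "\<And>j x. j \<in> {1..d} \<Longrightarrow> x \<in> {iet_pt \<mu> (j - 1)..iet_pt \<mu> j} \<Longrightarrow>
       pwi_map \<theta> lam j (H x) = H (x + iet_trans d \<pi> \<mu> j)"
proof -
  note d = iet_dataD[OF iet]
  have d_in: "d \<in> {1..d}" using d(1) by simp
  define xd where "xd = iet_pt \<mu> d"
  define xd' where "xd' = iet_pt \<mu> (d - 1)"
  define \<tau> where "\<tau> = iet_trans d \<pi> \<mu> d"
  define H where "H x = (if x < xd then h x else inv (pwi_map \<theta> lam d) (h (x + \<tau>)))" for x
  have xd': "iet_pt \<mu> 0 \<le> xd'" "xd' < xd"
    unfolding xd_def xd'_def
    using iet_pt_mono[OF iet] iet_pt_strict_mono[OF iet] d(1) by auto
  have cont_h: "continuous_on {iet_pt \<mu> 0..<xd} h"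
    using emb by (simp add: continuous_embedding_def iet_dom_def xd_def)
  have conj: "pwi_map \<theta> lam j (h x) = h (x + iet_trans d \<pi> \<mu> j)"
    if "j \<in> {1..d}" "x \<in> iet_int \<mu> j" for j x
  proof -
    have "x \<in> iet_dom d \<mu>"
      using that iet_pt_mono[OF iet, of 0 "j - 1"] iet_pt_mono[OF iet, of j d]
      by (fastforce simp: iet_int_def iet_dom_def)
    moreover have "h ` iet_int \<mu> j \<subseteq> A j"
      using emb that(1) by (simp add: continuous_embedding_def pw_continuous_embedding_def)
    then have "h x \<in> A j" using that(2) by blast
    ultimately show ?thesis
      using emb pwi that iet_eq[OF iet that]
      by (metis continuous_embedding_def is_pwi_def pw_continuous_embedding_def)
  qed
  have image_d: "x + \<tau> \<in> {iet_pt \<mu> 0..<xd}" if "x \<in> {xd'..xd}" for x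
  proof -
    have "iet_image_pt d \<pi> \<mu> (\<pi> d) < xd"
    proof -
      have "inv \<pi> d \<in> {1..d}" using d(2) d_in by (metis permutes_inv permutes_in_image)
      then have "iet_image_pt d \<pi> \<mu> (d - 1) < iet_image_pt d \<pi> \<mu> d"
        using iet_image_pt_succ[OF iet, of "inv \<pi> d"] d(3) permutes_inverses(1)[OF d(2)] by simp
      moreover have "iet_image_pt d \<pi> \<mu> (\<pi> d) \<le> iet_image_pt d \<pi> \<mu> (d - 1)"
        using iet_image_pt_mono[OF iet] irreducible_perm_last[OF iet] by simp
      ultimately show ?thesis using iet_image_pt_d[OF iet] by (simp add: xd_def)
    qed
    then show ?thesis
      using iet_trans_closed_interval[OF iet d_in, of x] that by (auto simp: xd_def xd'_def \<tau>_def)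
  qed
  have H_last: "H x = inv (pwi_map \<theta> lam d) (h (x + \<tau>))" if "x \<in> {xd'..xd}" for x
  proof (cases "x < xd")
    case True
    then have "pwi_map \<theta> lam d (h x) = h (x + \<tau>)"
      unfolding \<tau>_def using that d_in by (intro conj) (auto simp: iet_int_def xd_def xd'_def)
    then have "inv (pwi_map \<theta> lam d) (h (x + \<tau>)) = h x"
      using inv_pwi_map_apply by metis
    then show ?thesis using True by (simp add: H_def)
  qed (simp add: H_def)
  have "continuous_on ({iet_pt \<mu> 0..xd'} \<union> {xd'..xd}) H"
  proof (rule continuous_on_closed_Un)
    show "continuous_on {iet_pt \<mu> 0..xd'} H"
    proof (subst continuous_on_cong[OF refl])
      show "H x = h x" if "x \<in> {iet_pt \<mu> 0..xd'}" for x
        using that xd'(2) by (simp add: H_def)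
      show "continuous_on {iet_pt \<mu> 0..xd'} h"
        by (rule continuous_on_subset[OF cont_h]) (use xd' in auto)
    qed
    show "continuous_on {xd'..xd} H"
    proof (subst continuous_on_cong[OF refl H_last])
      have "continuous_on {xd'..xd} (\<lambda>x. h (x + \<tau>))"
      proof (rule continuous_on_compose2[OF cont_h])
        show "(\<lambda>x. x + \<tau>) ` {xd'..xd} \<subseteq> {iet_pt \<mu> 0..<xd}" using image_d by blast
      qed (intro continuous_intros)
      then show "continuous_on {xd'..xd} (\<lambda>x. inv (pwi_map \<theta> lam d) (h (x + \<tau>)))"
        by (rule continuous_on_compose2[OF continuous_on_inv_pwi_map[of UNIV]]) simp
    qed
  qed auto
  moreover have "{iet_pt \<mu> 0..xd'} \<union> {xd'..xd} = {iet_pt \<mu> 0..xd}" using xd' by auto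
  ultimately have cont_H: "continuous_on {iet_pt \<mu> 0..xd} H" by simp
  show thesis
  proof (rule that)
    show "continuous_on {iet_pt \<mu> 0..iet_pt \<mu> d} H" using cont_H by (simp add: xd_def)
    show "H x = h x" if "x \<in> iet_dom d \<mu>" for x
      using that by (simp add: H_def iet_dom_def xd_def)
  next
    fix j x assume j: "j \<in> {1..d}" and x: "x \<in> {iet_pt \<mu> (j - 1)..iet_pt \<mu> j}"
    let ?I = "{iet_pt \<mu> (j - 1)..<iet_pt \<mu> j}"
    let ?D = "\<lambda>x. pwi_map \<theta> lam j (H x) - H (x + iet_trans d \<pi> \<mu> j)"
    have lt: "iet_pt \<mu> (j - 1) < iet_pt \<mu> j" using iet_pt_strict_mono[OF iet] j by simp
    have cl: "closure ?I = {iet_pt \<mu> (j - 1)..iet_pt \<mu> j}"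
      by (rule closure_atLeastLessThan[OF lt])
    have dom: "iet_pt \<mu> 0 \<le> iet_pt \<mu> (j - 1)" "iet_pt \<mu> j \<le> xd"
      "iet_image_pt d \<pi> \<mu> (\<pi> j) \<le> xd"
      unfolding xd_def
      using iet_pt_mono[OF iet, of 0 "j - 1"] iet_pt_mono[OF iet, of j d]
        iet_image_pt_mono[OF iet, of "\<pi> j" d] iet_image_pt_d[OF iet] j d(4)[OF j]
      by auto
    have "continuous_on (closure ?I) (\<lambda>x. pwi_map \<theta> lam j (H x))"
      unfolding cl
      by (rule continuous_on_compose2[OF continuous_on_pwi_map[of UNIV]
            continuous_on_subset[OF cont_H]]) (use dom in auto)
    moreover have "continuous_on (closure ?I) (\<lambda>x. H (x + iet_trans d \<pi> \<mu> j))"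
      unfolding cl
    proof (rule continuous_on_compose2[OF cont_H])
      show "(\<lambda>x. x + iet_trans d \<pi> \<mu> j) ` {iet_pt \<mu> (j - 1)..iet_pt \<mu> j} \<subseteq> {iet_pt \<mu> 0..xd}"
        using iet_trans_closed_interval[OF iet j] dom(3) by fastforce
    qed (intro continuous_intros)
    ultimately have "continuous_on (closure ?I) ?D" by (intro continuous_on_diff)
    moreover have "?D x = 0" if "x \<in> ?I" for x
    proof -
      have "x + iet_trans d \<pi> \<mu> j < xd"
        using iet_trans_right[OF iet j] dom(3) that by auto
      moreover have "x < xd" using dom(2) that by auto
      ultimately show ?thesis using conj[OF j] that by (simp add: H_def iet_int_def)
    qed
    ultimately have "?D x = 0"
      by (rule continuous_constant_on_closure) (use x cl in auto)
    then show "pwi_map \<theta> lam j (H x) = H (x + iet_trans d \<pi> \<mu> j)" by simp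
  qed
qed

text \<open>At an edge both sides are the value of the extended curve at the common end of two neighbouring
  exchanged intervals.  The outside label \<open>0\<close> fits in twice: at \<open>a = 0\<close> the common end is \<open>x\<^sub>0\<close>, and
  when \<open>0\<close> is the right neighbour of \<open>a\<close> it is \<open>x\<^sub>d\<close>, because \<open>[0 - 1] = d\<close>.\<close>

lemma embedding_vertex_points:
  assumes iet: "iet_data d \<pi> \<mu>" and pwi: "is_pwi d X A T \<theta> lam"
    and emb: "continuous_embedding d \<pi> \<mu> X A T h"
  obtains V where "\<And>a. a \<le> d \<Longrightarrow>
    pwi_map \<theta> lam (right_neighbour d \<pi> a) (V (conn_next d \<pi> a)) = pwi_map \<theta> lam a (V a)"
proof -
  note d = iet_dataD[OF iet]
  obtain H where "continuous_on {iet_pt \<mu> 0..iet_pt \<mu> d} H"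
    and "\<And>x. x \<in> iet_dom d \<mu> \<Longrightarrow> H x = h x"
    and H: "\<And>j x. j \<in> {1..d} \<Longrightarrow> x \<in> {iet_pt \<mu> (j - 1)..iet_pt \<mu> j} \<Longrightarrow>
       pwi_map \<theta> lam j (H x) = H (x + iet_trans d \<pi> \<mu> j)"
    by (rule embedding_extends_to_closure[OF iet pwi emb]) (rule that)
  have \<pi>0: "\<pi> 0 = 0" using permutes_not_in[OF d(2), of 0] by simp
  have le: "iet_pt \<mu> (j - 1) \<le> iet_pt \<mu> j" if "j \<in> {1..d}" for j
    using iet_pt_mono[OF iet] that by simp
  have right: "pwi_map \<theta> lam a (H (iet_pt \<mu> a)) = H (iet_image_pt d \<pi> \<mu> (\<pi> a))" if "a \<le> d" for a
  proof (cases "a = 0")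
    case True
    then show ?thesis by (simp add: pwi_map_def \<pi>0 iet_image_pt_0[OF iet])
  next
    case False
    then have a: "a \<in> {1..d}" using that by simp
    show ?thesis using H[OF a, of "iet_pt \<mu> a"] le[OF a] iet_trans_right[OF iet a] by simp
  qed
  have left: "pwi_map \<theta> lam b (H (iet_pt \<mu> (idx d (int b - 1)))) =
      H (iet_image_pt d \<pi> \<mu> (idx d (int (\<pi> b) - 1)))" if "b \<le> d" for b
  proof (cases "b = 0")
    case True
    have "idx d (- 1) = d" by (simp add: idx_def zmod_minus1)
    then show ?thesis using True by (simp add: pwi_map_def \<pi>0 iet_image_pt_d[OF iet])
  next
    case False
    then have b: "b \<in> {1..d}" using that by simp
    have pred: "idx d (int c - 1) = c - 1" if "c \<in> {1..d}" for c
    proof -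
      have "int c - 1 = int (c - 1)" "c - 1 \<le> d" using that by auto
      then show ?thesis by (simp only: idx_of_nat)
    qed
    show ?thesis
      using H[OF b, of "iet_pt \<mu> (b - 1)"] le[OF b] iet_trans_left[OF iet b]
        pred[OF b] pred[OF d(4)[OF b]] by simp
  qed
  show thesis
  proof (rule that)
    fix a assume a: "a \<le> d"
    have "right_neighbour d \<pi> a \<le> d"
      using bij_betwE[OF bij_betw_right_neighbour[OF d(2)]] a by simp
    moreover have "idx d (int (\<pi> (right_neighbour d \<pi> a)) - 1) = \<pi> a"
      using perm_le[OF d(2) a]
      by (simp add: right_neighbour_def permutes_inverses[OF d(2)] idx_idx_pred idx_of_nat)
    ultimately show "pwi_map \<theta> lam (right_neighbour d \<pi> a) (H (iet_pt \<mu> (conn_next d \<pi> a))) =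
        pwi_map \<theta> lam a (H (iet_pt \<mu> a))"
      using left right[OF a] by (simp add: conn_next_def)
  qed
qed

section \<open>The parametric connecting equation\<close>

theorem theorem3p4:
  fixes d :: nat and \<pi> :: "nat \<Rightarrow> nat" and \<mu> :: "nat \<Rightarrow> real"
    and X :: "complex set" and A :: "nat \<Rightarrow> complex set" and T :: "complex \<Rightarrow> complex"
    and \<theta> :: "nat \<Rightarrow> real" and lam :: "nat \<Rightarrow> complex" and h :: "real \<Rightarrow> complex"
  assumes "iet_data d \<pi> \<mu>"
    and "iet_minimal d \<pi> \<mu>"
    and "is_pwi d X A T \<theta> lam"
    and "continuous_embedding d \<pi> \<mu> X A T h"
    and "Digraph_Component.connected (with_proj (conn_graph d \<pi>))"
  shows "\<forall>p\<in>{0..d}. (\<Sum>j=1..d. lam j * conn_coeff d \<pi> p \<theta> j) = 0"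
proof
  fix p assume "p \<in> {0..d}"
  then have p: "p \<le> d" by simp
  note \<pi> = iet_dataD(2)[OF assms(1)]
  obtain V where V: "\<And>a. a \<le> d \<Longrightarrow>
      pwi_map \<theta> lam (right_neighbour d \<pi> a) (V (conn_next d \<pi> a)) = pwi_map \<theta> lam a (V a)"
    using embedding_vertex_points[OF assms(1,3,4)] by blast
  have "conn_map d \<pi> \<theta> lam p (V p) = V p"
    by (rule conn_map_fixed_point[OF \<pi> p V])
  then have "conn_map d \<pi> \<theta> lam p 0 = 0"
    using conn_map_translation[OF \<pi> p assms(5), of \<theta> lam 0 "V p"] by simp
  then show "(\<Sum>j=1..d. lam j * conn_coeff d \<pi> p \<theta> j) = 0"
    using conn_map_zero_eq[OF \<pi> p] by simp
qed

end
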